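(* For every transaction fee $\alpha\in[0,1)$ there exist a market $(S,B,\mathbf v,G)$ and a Platform Equilibrium in pure strategies $P\subseteq S$ at fee $\alpha$ such that the ratio of optimal welfare to social welfare is $$\frac{W^\star(S,B,\mathbf v)}{W(S,B,G(P))}=\frac{2-\alpha}{1-\alpha}.$$
   Context: A market $(S,B,\mathbf v,G)$ consists of a finite set $B=\{1,\dots,n\}$ of buyers, a finite set $S=\{1,\dots,m\}$ of sellers (each owning one item), values $v_{ij}\ge 0$ of buyer $i$ for seller $j$'s item (each buyer is unit-demand), and a bipartite graph $G$ between $B$ and $S$ whose edges are the pairs that can transact directly. $W(S',B',G)$ denotes the maximum of $\sum v_{ij}$ over matchings between $B'\subseteq B$ and $S'\subseteq S$ that use only edges of $G$. The optimal welfare $W^\star(S,B,\mathbf v)$ is $W(S,B,K)$ where $K$ is the complete bipartite graph between $B$ and $S$. For a set $P\subseteq S$ of sellers joining the platform, $G(P)$ is the graph obtained from $G$ by adding all edges between $P$ and $B$. The market then clears at the maximum competitive (Walrasian) equilibrium prices with respect to $G(P)$, which equal $p_j(P)=W(S,B,G(P))-W(S\setminus\{j\},B,G(P))$, and the resulting social welfare is $W(S,B,G(P))$. At fee $\alpha$, a seller $j\in P$ has utility $(1-\alpha)p_j(P)$ and a seller $j\notin P$ has utility $p_j(P)$. A set $P\subseteq S$ is a pure Platform Equilibrium at fee $\alpha$ if for all $j\in P$: $(1-\alpha)p_j(P)\ge p_j(P\setminus\{j\})$, and for all $j\notin P$: $p_j(P)\ge(1-\alpha)p_j(P\cup\{j\})$.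 *)

theory Defs
  imports Complex_Main
begin

type_synonym graph = "(nat \<times> nat) set" \<comment> \<open>an edge is a pair (buyer, seller)\<close>
type_synonym valuation = "nat \<Rightarrow> nat \<Rightarrow> real" \<comment> \<open>\<open>v i j\<close>: value of buyer i for the item of seller j\<close>

text \<open>Buyers and sellers are numbered separately, so the same number may denote both a buyer
  and a seller.\<close>

definition market :: "nat set \<Rightarrow> nat set \<Rightarrow> valuation \<Rightarrow> graph \<Rightarrow> bool" where
  "market S B v G \<longleftrightarrow>
     (\<exists>m. S = {1..m}) \<and> (\<exists>n. B = {1..n}) \<and>
     (\<forall>i\<in>B. \<forall>j\<in>S. 0 \<le> v i j) \<and>
     G \<subseteq> B \<times> S"

definition matching :: "nat set \<Rightarrow> nat set \<Rightarrow> graph \<Rightarrow> (nat \<times> nat) set \<Rightarrow> bool" where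
  "matching S B G M \<longleftrightarrow> M \<subseteq> G \<inter> (B \<times> S) \<and> inj_on fst M \<and> inj_on snd M"

text \<open>The maximum is over a finite set whenever \<open>S\<close> and \<open>B\<close> are finite, and over a nonempty one
  because the empty matching is always allowed.\<close>

definition welfare :: "valuation \<Rightarrow> nat set \<Rightarrow> nat set \<Rightarrow> graph \<Rightarrow> real" where
  "welfare v S B G = Max {(\<Sum>(i, j)\<in>M. v i j) | M. matching S B G M}"

definition optimal_welfare :: "nat set \<Rightarrow> nat set \<Rightarrow> valuation \<Rightarrow> real" where
  "optimal_welfare S B v = welfare v S B (B \<times> S)"

definition join_graph :: "nat set \<Rightarrow> graph \<Rightarrow> nat set \<Rightarrow> graph" where
  "join_graph B G P = G \<union> B \<times> P"

text \<open>The maximum competitive (Walrasian) equilibrium price of seller \<open>j\<close> when the sellers in \<open>P\<close>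
  join: the marginal contribution of \<open>j\<close> to the welfare on \<open>G(P)\<close>.\<close>

definition price :: "nat set \<Rightarrow> nat set \<Rightarrow> valuation \<Rightarrow> graph \<Rightarrow> nat set \<Rightarrow> nat \<Rightarrow> real" where
  "price S B v G P j =
     welfare v S B (join_graph B G P) - welfare v (S - {j}) B (join_graph B G P)"

definition seller_utility ::
  "real \<Rightarrow> nat set \<Rightarrow> nat set \<Rightarrow> valuation \<Rightarrow> graph \<Rightarrow> nat set \<Rightarrow> nat \<Rightarrow> real" where
  "seller_utility \<alpha> S B v G P j =
     (if j \<in> P then (1 - \<alpha>) * price S B v G P j else price S B v G P j)"

definition pure_platform_equilibrium ::
  "real \<Rightarrow> nat set \<Rightarrow> nat set \<Rightarrow> valuation \<Rightarrow> graph \<Rightarrow> nat set \<Rightarrow> bool" where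
  "pure_platform_equilibrium \<alpha> S B v G P \<longleftrightarrow>
     P \<subseteq> S \<and>
     (\<forall>j\<in>P. seller_utility \<alpha> S B v G P j \<ge> seller_utility \<alpha> S B v G (P - {j}) j) \<and>
     (\<forall>j\<in>S - P. seller_utility \<alpha> S B v G P j \<ge> seller_utility \<alpha> S B v G (insert j P) j)"

end

theory Submission
  imports Defs
begin

text \<open>Two buyers and two sellers suffice, with only buyer 1 and seller 1 connected in \<open>G\<close>. With
  values \<open>v 1 1 = v 1 2 = 1 - \<alpha>\<close>, \<open>v 2 1 = 1\<close> and \<open>v 2 2 = 0\<close>, nobody wants to join: seller 1 sells
  at \<open>1 - \<alpha>\<close> off the platform and would sell at 1 on it, but then keeps only \<open>1 - \<alpha>\<close>; seller 2
  would merely compete with seller 1 for buyer 1, hence sell at price 0. So \<open>P = {}\<close> is an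
  equilibrium with welfare \<open>1 - \<alpha>\<close>, while serving both buyers crosswise gives \<open>2 - \<alpha>\<close>. All
  welfares are certified by linear programming duality.\<close>

text \<open>Weak duality: every matched edge is paid for by the duals of its endpoints, injectivity
  charges each vertex at most once, and nonnegativity allows adding the unmatched vertices.\<close>

lemma sum_matching_le_dual:
  fixes u p :: "nat \<Rightarrow> real"
  assumes "finite S" "finite B" and M: "matching S B G M"
    and nonneg: "\<And>i. i \<in> B \<Longrightarrow> 0 \<le> u i" "\<And>j. j \<in> S \<Longrightarrow> 0 \<le> p j"
    and cover: "\<And>i j. (i, j) \<in> G \<Longrightarrow> i \<in> B \<Longrightarrow> j \<in> S \<Longrightarrow> v i j \<le> u i + p j"
  shows "(\<Sum>(i, j)\<in>M. v i j) \<le> sum u B + sum p S"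
proof -
  have sub: "M \<subseteq> G \<inter> (B \<times> S)" and inj: "inj_on fst M" "inj_on snd M"
    using M by (auto simp: matching_def)
  have "(\<Sum>(i, j)\<in>M. v i j) \<le> (\<Sum>e\<in>M. u (fst e) + p (snd e))"
    by (rule sum_mono) (use sub in \<open>auto intro!: cover\<close>)
  also have "\<dots> = sum u (fst ` M) + sum p (snd ` M)"
    by (simp add: sum.distrib sum.reindex inj)
  also have "\<dots> \<le> sum u B + sum p S"
    by (intro add_mono sum_mono2) (use sub nonneg assms(1,2) in auto)
  finally show ?thesis .
qed

text \<open>Replaces the maximum over all matchings by a certificate: one matching and one dual
  cover of equal value.\<close>

lemma welfare_eqI:
  fixes u p :: "nat \<Rightarrow> real"
  assumes "finite S" "finite B" and M: "matching S B G M"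
    and "\<And>i. i \<in> B \<Longrightarrow> 0 \<le> u i" "\<And>j. j \<in> S \<Longrightarrow> 0 \<le> p j"
    and "\<And>i j. (i, j) \<in> G \<Longrightarrow> i \<in> B \<Longrightarrow> j \<in> S \<Longrightarrow> v i j \<le> u i + p j"
    and eq: "(\<Sum>(i, j)\<in>M. v i j) = sum u B + sum p S"
  shows "welfare v S B G = (\<Sum>(i, j)\<in>M. v i j)"
  unfolding welfare_def
proof (rule Max_eqI)
  have "{M. matching S B G M} \<subseteq> Pow (B \<times> S)"
    by (auto simp: matching_def)
  then have "finite {M. matching S B G M}"
    using assms(1,2) by (simp add: finite_subset)
  then show "finite {(\<Sum>(i, j)\<in>M. v i j) | M. matching S B G M}"
    by simp
  show "(\<Sum>(i, j)\<in>M. v i j) \<in> {(\<Sum>(i, j)\<in>M. v i j) | M. matching S B G M}"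
    using M by blast
  show "y \<le> (\<Sum>(i, j)\<in>M. v i j)" if "y \<in> {(\<Sum>(i, j)\<in>M. v i j) | M. matching S B G M}" for y
    using that sum_matching_le_dual[OF assms(1,2) _ assms(4-6)] eq by auto
qed

theorem theorem5p4:
  fixes \<alpha> :: real
  assumes "0 \<le> \<alpha>" and "\<alpha> < 1"
  shows "\<exists>S B v G P.
           market S B v G \<and>
           pure_platform_equilibrium \<alpha> S B v G P \<and>
           optimal_welfare S B v / welfare v S B (join_graph B G P) = (2 - \<alpha>) / (1 - \<alpha>)"
proof -
  define v :: valuation where
    "v = (\<lambda>i j. if i = 1 then 1 - \<alpha> else if j = 1 then 1 else 0)"
  define G :: graph where "G = {(1, 1)}"
  define B :: "nat set" where "B = {1, 2}"
  define S :: "nat set" where "S = {1, 2}"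
  \<comment> \<open>Together \<open>u\<close> and \<open>p\<close> cover all four pairs, tightly on
    (1, 2) and (2, 1). Alone, \<open>u\<close> fails at most on (2, 1), and \<open>p\<close> at most
    on (1, 2).\<close>
  define u :: "nat \<Rightarrow> real" where "u = (\<lambda>i. if i = 1 then 1 - \<alpha> else 0)"
  define p :: "nat \<Rightarrow> real" where "p = (\<lambda>j. if j = 1 then 1 else 0)"
  note defs = v_def G_def B_def S_def u_def p_def join_graph_def matching_def

  have none: "welfare v S B (join_graph B G {}) = 1 - \<alpha>"
    using assms
    by (subst welfare_eqI[where M = "{(1, 1)}" and u = u and p = "\<lambda>_. 0"])
      (auto simp: defs)
  have none_minus1: "welfare v (S - {1}) B (join_graph B G {}) = 0"
    using assms
    by (subst welfare_eqI[where M = "{}" and u = "\<lambda>_. 0" and p = "\<lambda>_. 0"])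
      (auto simp: defs)
  have none_minus2: "welfare v (S - {2}) B (join_graph B G {}) = 1 - \<alpha>"
    using assms
    by (subst welfare_eqI[where M = "{(1, 1)}" and u = u and p = "\<lambda>_. 0"])
      (auto simp: defs)
  have join1: "welfare v S B (join_graph B G {1}) = 1"
    using assms
    by (subst welfare_eqI[where M = "{(2, 1)}" and u = "\<lambda>_. 0" and p = p])
      (auto simp: defs)
  have join1_minus1: "welfare v (S - {1}) B (join_graph B G {1}) = 0"
    using assms
    by (subst welfare_eqI[where M = "{}" and u = "\<lambda>_. 0" and p = "\<lambda>_. 0"])
      (auto simp: defs)
  \<comment> \<open>The new edges compete for buyer 1 or are worth 0, so \<open>u\<close> still
    covers.\<close>
  have join2: "welfare v S B (join_graph B G {2}) = 1 - \<alpha>"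
    using assms
    by (subst welfare_eqI[where M = "{(1, 1)}" and u = u and p = "\<lambda>_. 0"])
      (auto simp: defs)
  have join2_minus2: "welfare v (S - {2}) B (join_graph B G {2}) = 1 - \<alpha>"
    using assms
    by (subst welfare_eqI[where M = "{(1, 1)}" and u = u and p = "\<lambda>_. 0"])
      (auto simp: defs)
  have optimum: "optimal_welfare S B v = 2 - \<alpha>"
    using assms unfolding optimal_welfare_def
    by (subst welfare_eqI[where M = "{(1, 2), (2, 1)}" and u = u and p = p])
      (auto simp: defs)

  have "S = {1..2}" "B = {1..2}"
    by (auto simp: S_def B_def)
  then have "market S B v G"
    using assms by (auto simp: market_def v_def G_def)
  \<comment> \<open>Both sellers are indifferent: seller 1 gets 1 - \<alpha> either way, seller 2
    gets 0.\<close>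
  moreover have "pure_platform_equilibrium \<alpha> S B v G {}"
    using none none_minus1 none_minus2 join1 join1_minus1 join2 join2_minus2
    by (auto simp: pure_platform_equilibrium_def seller_utility_def price_def S_def)
  moreover have "optimal_welfare S B v / welfare v S B (join_graph B G {}) = (2 - \<alpha>) / (1 - \<alpha>)"
    by (simp add: optimum none)
  ultimately show ?thesis
    by blast
qed

end
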